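(* Let $N\ge1$, let $y_{\rm obs}^1,\ldots,y_{\rm obs}^N\in\mathbb{R}^{N_y}$ be given observations, and let $\pi_{Z^0}$ be a given PDF on ${\cal Z}$. For $n=1,\ldots,N$ let $\pi_{\rm data}^n(\cdot|\cdot)$ be a Markov transition kernel on ${\cal Z}$ satisfying the consistency condition \[ \pi_{Z^n}(z|y_{\rm obs}^{1:n})=\int_{\cal Z}\pi_{\rm data}^n(z|z')\,\pi_{Z^n}(z'|y_{\rm obs}^{1:n-1})\,{\rm d}z', \] where $\pi_{Z^n}(\cdot|y_{\rm obs}^{1:n-1})$ and $\pi_{Z^n}(\cdot|y_{\rm obs}^{1:n})$ are the forecast and analysis PDFs defined in the context. Let $\hat Z^{0:N}=(\hat Z^0,\ldots,\hat Z^N)$ be the finite-time stochastic process induced by the McKean-Markov transition kernels \[ \pi^n(z^n|z^{n-1}):=\pi_{\rm data}^n(z^n|\Psi(z^{n-1})),\qquad n=1,\ldots,N, \] i.e. the time-inhomogeneous Markov chain with $\hat Z^0=Z^0\sim\pi_{Z^0}$ and transition kernel $\pi^n$ from $\hat Z^{n-1}$ to $\hat Z^n$. Then the final time marginal distribution $\pi_{Z^N}(z^N|y_{\rm obs}^{1:N})$ of the Feynman-Kac distribution $\mu_N$ on ${\cal Z}^{N+1}$ (defined in the context), i.e. its marginal in the variable $z^N$, is identical to the final time marginal distribution $\pi_{\hat Z^N}(z^N|y_{\rm obs}^{1:N})$ of $\hat Z^{0:N}$, i.e. the distribution of $\hat Z^N$.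
   Context: Setting: ${\cal Z}\subseteq\mathbb{R}^{N_z}$ is a Borel set, and $\Psi:\mathbb{R}^{N_z}\to\mathbb{R}^{N_z}$ is a diffeomorphism with $\Psi({\cal Z})\subseteq{\cal Z}$, defining the deterministic dynamical system $z^{n+1}=\Psi(z^n)$. $|D\Psi^{-1}(z)|$ denotes the absolute value of the determinant of the Jacobian matrix of $\Psi^{-1}$ at $z$. PDFs on ${\cal Z}$ are densities with respect to Lebesgue measure and are regarded as being zero outside ${\cal Z}$. $Z^0$ is a random variable with PDF $\pi_{Z^0}$. Observation model: $h:{\cal Z}\to\mathbb{R}^{N_y}$ is a (Borel measurable) forward map, $R\in\mathbb{R}^{N_y\times N_y}$ is a symmetric positive definite covariance matrix, and the likelihood is \[ \pi_Y(y|z)=\frac{1}{(2\pi)^{N_y/2}|R|^{1/2}}\,e^{-\frac12 (h(z)-y)^TR^{-1}(h(z)-y)}. \] The notation $y_{\rm obs}^{1:n}$ stands for $(y_{\rm obs}^1,\ldots,y_{\rm obs}^n)$, with $y_{\rm obs}^{1:0}$ meaning no observations. Forecast and analysis PDFs: starting from $\pi_{Z^0}(z|y_{\rm obs}^{1:0}):=\pi_{Z^0}(z)$, define recursively for $n=1,\ldots,N$ the forecast PDF \[ \pi_{Z^n}(z|y_{\rm obs}^{1:n-1}) = \pi_{Z^{n-1}}(\Psi^{-1}(z)|y_{\rm obs}^{1:n-1})\,|D\Psi^{-1}(z)| \] and the analysis PDF \[ \pi_{Z^n}(z|y_{\rm obs}^{1:n}) = \frac{\pi_Y(y_{\rm obs}^n|z)\,\pi_{Z^n}(z|y_{\rm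 obs}^{1:n-1})}{\int_{\cal Z}\pi_Y(y_{\rm obs}^n|z')\,\pi_{Z^n}(z'|y_{\rm obs}^{1:n-1})\,{\rm d}z'}. \] Transition kernels: a kernel $\pi_{\rm data}^n(z|z')$ is written formally as a density in $z$ but may contain Dirac delta parts; rigorously it is a Markov kernel $\pi_{\rm data}^n({\rm d}z|z')$ on ${\cal Z}$, and the consistency condition means $\int_{\cal Z}\pi_{\rm data}^n(B|z')\,\pi_{Z^n}(z'|y_{\rm obs}^{1:n-1})\,{\rm d}z'=\int_B\pi_{Z^n}(z|y_{\rm obs}^{1:n})\,{\rm d}z$ for all Borel sets $B\subseteq{\cal Z}$. Feynman-Kac distribution: formally, this is the distribution on trajectories $z^{0:N}=(z^0,\ldots,z^N)$ with density \[ \pi_{Z^{0:N}}(z^{0:N}|y_{\rm obs}^{1:N})=\frac1C\prod_{n=1}^N e^{-\frac12(h(z^n)-y_{\rm obs}^n)^TR^{-1}(h(z^n)-y_{\rm obs}^n)}\;\pi_{Z^0}(z^0)\prod_{n=1}^N\delta(z^n-\Psi(z^{n-1})), \] where $\delta$ is the Dirac delta and $C>0$ is the normalization constant. Rigorously, $\mu_N$ is the probability measure on ${\cal Z}^{N+1}$ given for Borel sets $A$ by \[ \mu_N(A)=\frac1C\int_{\cal Z}\mathbf{1}_A\big(z^0,\Psi(z^0),\ldots,\Psi^N(z^0)\big)\prod_{n=1}^N e^{-\frac12(h(\Psi^n(z^0))-y_{\rm obs}^n)^TR^{-1}(h(\Psi^n(z^0))-y_{\rm obs}^n)}\;\pi_{Z^0}(z^0)\,{\rm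 d}z^0, \] where $\Psi^n$ is the $n$-fold composition of $\Psi$ and $C>0$ makes $\mu_N({\cal Z}^{N+1})=1$. *)

theory Defs
  imports "HOL-Probability.Probability"
begin

definition C1_map :: "(real^'d \<Rightarrow> real^'d) \<Rightarrow> bool" where
  "C1_map f \<longleftrightarrow> f differentiable_on UNIV \<and> continuous_on UNIV (\<lambda>z. jacobian f (at z))"

definition diffeomorphism :: "(real^'d \<Rightarrow> real^'d) \<Rightarrow> bool" where
  "diffeomorphism \<Psi> \<longleftrightarrow> bij \<Psi> \<and> C1_map \<Psi> \<and> C1_map (inv \<Psi>)"

definition sym_pos_def :: "real^'m^'m \<Rightarrow> bool" where
  "sym_pos_def R \<longleftrightarrow> transpose R = R \<and> (\<forall>v. v \<noteq> 0 \<longrightarrow> v \<bullet> (R *v v) > 0)"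

definition is_pdf :: "(real^'d) set \<Rightarrow> (real^'d \<Rightarrow> real) \<Rightarrow> bool" where
  "is_pdf Z p \<longleftrightarrow> p \<in> borel_measurable borel \<and> (\<forall>z. 0 \<le> p z) \<and> (\<forall>z. z \<notin> Z \<longrightarrow> p z = 0) \<and>
     (\<integral>\<^sup>+z\<in>Z. ennreal (p z) \<partial>lborel) = 1"

definition misfit_weight :: "(real^'d \<Rightarrow> real^'m) \<Rightarrow> real^'m^'m \<Rightarrow> real^'m \<Rightarrow> real^'d \<Rightarrow> real" where
  "misfit_weight h R y z = exp (- (1/2) * ((h z - y) \<bullet> (matrix_inv R *v (h z - y))))"

definition likelihood :: "(real^'d \<Rightarrow> real^'m) \<Rightarrow> real^'m^'m \<Rightarrow> real^'m \<Rightarrow> real^'d \<Rightarrow> real" where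
  "likelihood h R y z =
     1 / ((2 * pi) powr (real CARD('m) / 2) * sqrt (det R)) * misfit_weight h R y z"

definition transport_pdf :: "(real^'d \<Rightarrow> real^'d) \<Rightarrow> (real^'d \<Rightarrow> real) \<Rightarrow> real^'d \<Rightarrow> real" where
  "transport_pdf \<Psi> p z = p (inv \<Psi> z) * \<bar>det (jacobian (inv \<Psi>) (at z))\<bar>"

definition bayes_pdf ::
  "(real^'d) set \<Rightarrow> (real^'d \<Rightarrow> real) \<Rightarrow> (real^'d \<Rightarrow> real) \<Rightarrow> real^'d \<Rightarrow> real" where
  "bayes_pdf Z L p z = L z * p z / (LINT z':Z|lborel. L z' * p z')"

primrec analysis_pdf ::
  "(real^'d) set \<Rightarrow> (real^'d \<Rightarrow> real^'d) \<Rightarrow> (real^'d \<Rightarrow> real^'m) \<Rightarrow> real^'m^'m \<Rightarrow>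
   (nat \<Rightarrow> real^'m) \<Rightarrow> (real^'d \<Rightarrow> real) \<Rightarrow> nat \<Rightarrow> real^'d \<Rightarrow> real" where
  "analysis_pdf Z \<Psi> h R y p\<^sub>0 0 = p\<^sub>0"
| "analysis_pdf Z \<Psi> h R y p\<^sub>0 (Suc n) =
     bayes_pdf Z (likelihood h R (y (Suc n))) (transport_pdf \<Psi> (analysis_pdf Z \<Psi> h R y p\<^sub>0 n))"

text \<open>Only meaningful for \<open>n \<ge> 1\<close>.\<close>

definition forecast_pdf ::
  "(real^'d) set \<Rightarrow> (real^'d \<Rightarrow> real^'d) \<Rightarrow> (real^'d \<Rightarrow> real^'m) \<Rightarrow> real^'m^'m \<Rightarrow>
   (nat \<Rightarrow> real^'m) \<Rightarrow> (real^'d \<Rightarrow> real) \<Rightarrow> nat \<Rightarrow> real^'d \<Rightarrow> real" where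
  "forecast_pdf Z \<Psi> h R y p\<^sub>0 n = transport_pdf \<Psi> (analysis_pdf Z \<Psi> h R y p\<^sub>0 (n - 1))"

definition markov_kernel :: "'s measure \<Rightarrow> ('s \<Rightarrow> 's measure) \<Rightarrow> bool" where
  "markov_kernel S K \<longleftrightarrow> K \<in> S \<rightarrow>\<^sub>M prob_algebra S"

definition maps_density_to ::
  "(real^'d) set \<Rightarrow> (real^'d \<Rightarrow> (real^'d) measure) \<Rightarrow> (real^'d \<Rightarrow> real) \<Rightarrow> (real^'d \<Rightarrow> real) \<Rightarrow> bool" where
  "maps_density_to Z K p q \<longleftrightarrow> (\<forall>B\<in>sets borel. B \<subseteq> Z \<longrightarrow>
     (\<integral>\<^sup>+z'\<in>Z. emeasure (K z') B * ennreal (p z') \<partial>lborel) = (\<integral>\<^sup>+z\<in>B. ennreal (q z) \<partial>lborel))"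

definition mckean_kernel ::
  "(real^'d \<Rightarrow> real^'d) \<Rightarrow> (nat \<Rightarrow> real^'d \<Rightarrow> (real^'d) measure) \<Rightarrow> nat \<Rightarrow> real^'d \<Rightarrow> (real^'d) measure" where
  "mckean_kernel \<Psi> K n z = K n (\<Psi> z)"

text \<open>The sigma-algebra generated by \<open>X 0, \<dots>, X (n - 1)\<close>.\<close>

definition past_algebra :: "'w measure \<Rightarrow> 's measure \<Rightarrow> (nat \<Rightarrow> 'w \<Rightarrow> 's) \<Rightarrow> nat \<Rightarrow> 'w measure" where
  "past_algebra M S X n =
     vimage_algebra (space M) (\<lambda>\<omega>. \<lambda>k\<in>{..<n}. X k \<omega>) (\<Pi>\<^sub>M k\<in>{..<n}. S)"

text \<open>The Markov property is \<open>P(X\<^sub>n \<in> B | X\<^sub>0, \<dots>, X\<^sub>n\<^sub>-\<^sub>1) = K\<^sub>n(B | X\<^sub>n\<^sub>-\<^sub>1)\<close> almost surely.\<close>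

definition markov_chain ::
  "'w measure \<Rightarrow> 's measure \<Rightarrow> nat \<Rightarrow> (nat \<Rightarrow> 's \<Rightarrow> 's measure) \<Rightarrow> (nat \<Rightarrow> 'w \<Rightarrow> 's) \<Rightarrow> bool" where
  "markov_chain M S N K X \<longleftrightarrow> prob_space M \<and> (\<forall>n\<le>N. X n \<in> M \<rightarrow>\<^sub>M S) \<and>
     (\<forall>n\<in>{1..N}. \<forall>B\<in>sets S. AE \<omega> in M.
        real_cond_exp M (past_algebra M S X n) (indicator (X n -` B \<inter> space M)) \<omega>
          = measure (K n (X (n - 1) \<omega>)) B)"

definition fk_weight ::
  "(real^'d \<Rightarrow> real^'d) \<Rightarrow> (real^'d \<Rightarrow> real^'m) \<Rightarrow> real^'m^'m \<Rightarrow> (nat \<Rightarrow> real^'m) \<Rightarrow>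
   (real^'d \<Rightarrow> real) \<Rightarrow> nat \<Rightarrow> real^'d \<Rightarrow> real" where
  "fk_weight \<Psi> h R y p\<^sub>0 N z = (\<Prod>n=1..N. misfit_weight h R (y n) ((\<Psi> ^^ n) z)) * p\<^sub>0 z"

definition fk_const ::
  "(real^'d) set \<Rightarrow> (real^'d \<Rightarrow> real^'d) \<Rightarrow> (real^'d \<Rightarrow> real^'m) \<Rightarrow> real^'m^'m \<Rightarrow>
   (nat \<Rightarrow> real^'m) \<Rightarrow> (real^'d \<Rightarrow> real) \<Rightarrow> nat \<Rightarrow> real" where
  "fk_const Z \<Psi> h R y p\<^sub>0 N = (LINT z:Z|lborel. fk_weight \<Psi> h R y p\<^sub>0 N z)"

text \<open>The delta factors concentrate the law on orbits of \<open>\<Psi>\<close>, so it is the image of a weighted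
  initial law on \<open>Z\<close> under \<open>z \<mapsto> (z, \<Psi> z, \<dots>, \<Psi>\<^sup>N z)\<close>.\<close>

definition feynman_kac ::
  "(real^'d) set \<Rightarrow> (real^'d \<Rightarrow> real^'d) \<Rightarrow> (real^'d \<Rightarrow> real^'m) \<Rightarrow> real^'m^'m \<Rightarrow>
   (nat \<Rightarrow> real^'m) \<Rightarrow> (real^'d \<Rightarrow> real) \<Rightarrow> nat \<Rightarrow> (nat \<Rightarrow> real^'d) measure" where
  "feynman_kac Z \<Psi> h R y p\<^sub>0 N =
     distr (density (restrict_space lborel Z)
              (\<lambda>z. ennreal (1 / fk_const Z \<Psi> h R y p\<^sub>0 N * fk_weight \<Psi> h R y p\<^sub>0 N z)))
           (\<Pi>\<^sub>M n\<in>{0..N}. restrict_space borel Z) (\<lambda>z. \<lambda>n\<in>{0..N}. (\<Psi> ^^ n) z)"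

end

theory Submission
  imports Defs
begin

text \<open>The law of the McKean chain at time \<open>n\<close> has the analysis density: pushing forward by \<open>\<Psi>\<close> turns
  the analysis density at time \<open>n - 1\<close> into the forecast density (change of variables), and the
  data kernel turns the latter into the analysis density at time \<open>n\<close> (consistency).  The Feynman-Kac
  weights, pushed forward along the orbit, follow the same forecast/Bayes recursion up to a constant
  factor at each step, so they too end in a multiple of the analysis density, and both laws are
  probability measures.\<close>

section \<open>Change of variables over an arbitrary finite index type\<close>

text \<open>The library proves the change of variables formula for well-ordered index types only.  The
  copy \<open>ranked\<close> of a finite type carries a well-order, and reindexing by it preserves Lebesgue
  measure and Jacobian determinants.\<close>

datatype 'i ranked = Rank (unrank: 'i)

lemma bij_Rank: "bij Rank"
  by (metis bijI' ranked.collapse ranked.inject)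

lemma bij_unrank: "bij unrank"
  by (metis bijI' ranked.expand ranked.sel)

instance ranked :: (finite) finite
proof
  show "finite (UNIV :: 'a ranked set)"
    using bij_betw_finite[OF bij_Rank] by (metis finite)
qed

instantiation ranked :: (finite) wellorder
begin

definition less_eq_ranked :: "'a ranked \<Rightarrow> 'a ranked \<Rightarrow> bool" where
  "less_eq_ranked a b \<longleftrightarrow> to_nat (unrank a) \<le> to_nat (unrank b)"

definition less_ranked :: "'a ranked \<Rightarrow> 'a ranked \<Rightarrow> bool" where
  "less_ranked a b \<longleftrightarrow> to_nat (unrank a) < to_nat (unrank b)"

instance
proof
  fix P :: "'a ranked \<Rightarrow> bool" and a :: "'a ranked"
  assume step: "\<And>x. (\<And>y. y < x \<Longrightarrow> P y) \<Longrightarrow> P x"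
  show "P a"
    by (induction a rule: measure_induct_rule[of "\<lambda>x. to_nat (unrank x)"])
      (auto intro: step simp: less_ranked_def)
qed (auto simp: less_eq_ranked_def less_ranked_def intro: ranked.expand)

end

text \<open>Conjugation by \<open>f\<close> is a sign-preserving bijection between the permutations
  of the two index types, and it matches the terms of the two Leibniz sums.\<close>

lemma det_reindex:
  fixes A :: "'a::comm_ring_1^'n^'n" and f :: "'m::finite \<Rightarrow> 'n"
  assumes "bij f"
  shows "det (\<chi> i j. A $ f i $ f j) = det A"
proof -
  let ?h = "\<lambda>p x. f (p (inv f x))"
  have bij: "bij_betw ?h {p. p permutes UNIV} {p. p permutes UNIV}"
    using bij_betw_permutations[OF assms] by simp
  have sgn: "sign (?h p) = sign p" if "p permutes UNIV" for p
  proof -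
    have "map_permutation UNIV f p = ?h p"
      using bij_is_surj[OF assms] by (simp add: map_permutation_def restrict_id_def fun_eq_iff)
    then show ?thesis
      using sign_map_permutation[OF bij_is_inj[OF assms] that finite] by simp
  qed
  have prod: "(\<Prod>i\<in>UNIV. A $ i $ ?h p i) = (\<Prod>i\<in>UNIV. A $ f i $ f (p i))" for p
    by (subst prod.reindex_bij_betw[OF assms, symmetric]) (simp add: bij_is_inj[OF assms])
  show ?thesis
    unfolding det_def
    by (subst sum.reindex_bij_betw[OF bij, symmetric], rule sum.cong) (simp_all add: sgn prod)
qed

lemma borel_measurable_det:
  assumes "A \<in> borel_measurable M"
  shows "(\<lambda>x. det (A x :: real^'n^'n)) \<in> borel_measurable M"
proof -
  have "(\<lambda>x. A x $ i $ j) \<in> borel_measurable M" for i j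
    by (intro borel_measurable_continuous_on[OF _ assms] continuous_intros)
  then show ?thesis
    unfolding det_def by measurable
qed

lemma borel_measurable_jacobian_det:
  fixes \<phi> :: "real^'n \<Rightarrow> real^'n"
  assumes "C1_map \<phi>"
  shows "(\<lambda>x. det (jacobian \<phi> (at x))) \<in> borel_measurable borel"
  using assms unfolding C1_map_def
  by (intro borel_measurable_det borel_measurable_continuous_onI) auto

lemma C1_map_borel: "C1_map \<phi> \<Longrightarrow> \<phi> \<in> borel_measurable borel"
  unfolding C1_map_def
  by (intro borel_measurable_continuous_onI differentiable_imp_continuous_on) auto

lemma C1_map_has_derivative:
  "C1_map \<phi> \<Longrightarrow> (\<phi> has_derivative (*v) (jacobian \<phi> (at x))) (at x)"
  using jacobian_works[of \<phi> "at x"] by (simp add: C1_map_def differentiable_on_def eta_contract_eq)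

text \<open>Volumes of boxes determine Lebesgue measure. Since \<open>\<phi>\<close> is bijective, a
  box is the image of its own preimage, so its volume is the integral of the absolute Jacobian
  determinant over that preimage, which is what the right-hand measure assigns to it.\<close>

lemma lborel_change_of_variables_wellorder:
  fixes \<phi> :: "real^'n::{finite,wellorder} \<Rightarrow> real^'n::_" and J :: "real^'n::_ \<Rightarrow> real^'n::_^'n::_"
  assumes "bij \<phi>" and meas [measurable]: "\<phi> \<in> borel_measurable borel" "(\<lambda>x. det (J x)) \<in> borel_measurable borel"
    and der: "\<And>x. (\<phi> has_derivative (*v) (J x)) (at x)"
  shows "lborel = distr (density lborel (\<lambda>x. ennreal \<bar>det (J x)\<bar>)) borel \<phi>"
proof (rule lborel_eqI)
  fix l u :: "real^'n::_"
  assume le: "\<And>b. b \<in> Basis \<Longrightarrow> l \<bullet> b \<le> u \<bullet> b"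
  let ?S = "\<phi> -` box l u"
  have S: "?S \<in> sets borel"
    using measurable_sets[OF meas(1), of "box l u"] by simp
  have img: "\<phi> ` ?S = box l u"
    using \<open>bij \<phi>\<close> by (simp add: bij_is_surj surj_image_vimage_eq)
  have "((\<lambda>x. \<bar>det (matrix ((*v) (J x)))\<bar>) has_integral measure lebesgue (box l u)) ?S"
    using has_measure_differentiable_image[of ?S \<phi> "\<lambda>x. (*v) (J x)" "measure lebesgue (box l u)"]
      S \<open>bij \<phi>\<close> der
    by (simp add: img has_derivative_at_withinI inj_on_subset[OF bij_is_inj] bij_is_surj)
  then have "(\<integral>\<^sup>+x. ennreal \<bar>det (J x)\<bar> * indicator ?S x \<partial>lborel) = ennreal (measure lebesgue (box l u))"
    by (intro nn_integral_has_integral_lebesgue') simp_all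
  then show "emeasure (distr (density lborel (\<lambda>x. ennreal \<bar>det (J x)\<bar>)) borel \<phi>) (box l u)
      = (\<Prod>b\<in>Basis. (u - l) \<bullet> b)"
    using S le by (simp add: emeasure_distr emeasure_density measure_lborel_box_eq)
qed simp

text \<open>A relabelling of coordinates pulls a box back to the box with relabelled corners, which
  has the same side lengths up to order and hence the same volume.\<close>

lemma lborel_distr_reindex:
  fixes f :: "'m::finite \<Rightarrow> 'n::finite"
  assumes "bij f"
  shows "lborel = distr lborel borel (\<lambda>x :: real^'n. (\<chi> i. x $ f i) :: real^'m)"
proof (rule lborel_eqI)
  fix l u :: "real^'m"
  assume le: "\<And>b. b \<in> Basis \<Longrightarrow> l \<bullet> b \<le> u \<bullet> b"
  let ?T = "\<lambda>x :: real^'n. (\<chi> i. x $ f i) :: real^'m"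
  let ?U = "\<lambda>x :: real^'m. (\<chi> i. x $ inv f i) :: real^'n"
  have T: "?T \<in> borel_measurable borel"
    by (intro borel_measurable_continuous_onI continuous_intros)
  have sf: "f (inv f i) = i" "inv f (f j) = j" for i j
    using assms by (auto simp: bij_is_surj surj_f_inv_f bij_is_inj)
  have "?T -` box l u = box (?U l) (?U u)"
  proof (intro set_eqI)
    fix x
    show "x \<in> ?T -` box l u \<longleftrightarrow> x \<in> box (?U l) (?U u)"
      by (simp add: mem_box_cart) (metis sf)
  qed
  moreover have le': "l $ i \<le> u $ i" for i
    using le[of "axis i 1"] by (simp add: inner_axis)
  moreover have "(\<Prod>b\<in>Basis. (?U u - ?U l) \<bullet> b) = (\<Prod>b\<in>Basis. (u - l) \<bullet> b)"
  proof -
    have B: "(\<Prod>b\<in>Basis. v \<bullet> b) = (\<Prod>i\<in>UNIV. v $ i)" for v :: "real^'k"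
    proof -
      have "Basis = (\<lambda>i. axis i (1::real)) ` (UNIV :: 'k set)"
        by (auto simp: Basis_vec_def)
      moreover have "inj (\<lambda>i. axis i (1::real) :: real^'k)"
        by (auto simp: inj_def axis_eq_axis)
      ultimately show ?thesis
        by (subst \<open>Basis = _\<close>, subst prod.reindex) (simp_all add: inner_axis)
    qed
    show ?thesis
      unfolding B
      by (subst prod.reindex_bij_betw[OF assms, symmetric]) (simp add: sf)
  qed
  ultimately show "emeasure (distr lborel borel ?T) (box l u) = (\<Prod>b\<in>Basis. (u - l) \<bullet> b)"
    using T by (subst emeasure_distr) (simp_all add: emeasure_lborel_box_eq Basis_vec_def inner_axis)
qed simp

text \<open>Conjugation by the relabelling \<open>T\<close>, with inverse \<open>U\<close>, turns
  \<open>\<phi>\<close> into a map \<open>\<phi>'\<close> over the well-ordered index type, where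
  the formula is known. Both relabellings preserve Lebesgue measure, and \<open>det_reindex\<close>
  shows that the Jacobian determinant is unchanged.\<close>

lemma lborel_change_of_variables:
  fixes \<phi> :: "real^'d \<Rightarrow> real^'d"
  assumes "bij \<phi>" and C1: "C1_map \<phi>"
  shows "lborel = distr (density lborel (\<lambda>x. ennreal \<bar>det (jacobian \<phi> (at x))\<bar>)) borel \<phi>"
proof -
  define T where "T = (\<lambda>x :: real^'d. (\<chi> i. x $ unrank i) :: real^('d ranked))"
  define U where "U = (\<lambda>x :: real^('d ranked). (\<chi> i. x $ Rank i) :: real^'d)"
  have TU [simp]: "T (U x) = x" "U (T z) = z" for x z
    by (simp_all add: T_def U_def vec_eq_iff)
  have [measurable]: "T \<in> borel_measurable borel" "U \<in> borel_measurable borel"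
    unfolding T_def U_def by (intro borel_measurable_continuous_onI continuous_intros)+
  have lT: "lborel = distr lborel borel T" and lU: "lborel = distr lborel borel U"
    unfolding T_def U_def using lborel_distr_reindex bij_unrank bij_Rank by blast+
  have linT: "bounded_linear T" and linU: "bounded_linear U"
    unfolding T_def U_def linear_conv_bounded_linear[symmetric]
    by (auto intro!: linearI simp: vec_eq_iff)
  define \<phi>' where "\<phi>' = T \<circ> \<phi> \<circ> U"
  define J where "J x = (\<chi> i j. jacobian \<phi> (at (U x)) $ unrank i $ unrank j)" for x
  note [measurable] = C1_map_borel[OF C1] borel_measurable_jacobian_det[OF C1]
  have bij': "bij \<phi>'"
    unfolding \<phi>'_def using \<open>bij \<phi>\<close>
    by (intro bij_comp o_bij[of T U] o_bij[of U T]) (auto simp: fun_eq_iff)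
  have det_J: "det (J x) = det (jacobian \<phi> (at (U x)))" for x
    unfolding J_def by (rule det_reindex[OF bij_unrank])
  have der: "(\<phi>' has_derivative (*v) (J x)) (at x)" for x
  proof -
    have "(\<phi>' has_derivative (\<lambda>v. T (jacobian \<phi> (at (U x)) *v U v))) (at x)"
      unfolding \<phi>'_def o_def
      by (intro bounded_linear.has_derivative[OF linT]
          has_derivative_compose[OF bounded_linear_imp_has_derivative[OF linU] C1_map_has_derivative[OF C1]])
    \<comment> \<open>The matrix of the conjugated linear map is the original one with rows and
      columns relabelled, so \<open>J\<close> is the Jacobian of \<open>\<phi>'\<close>.\<close>
    moreover have "T (A *v U v) = (\<chi> i j. A $ unrank i $ unrank j) *v v" for A v
      by (simp add: T_def U_def matrix_vector_mult_def vec_eq_iff)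
        (subst sum.reindex_bij_betw[OF bij_unrank, symmetric], simp)
    ultimately show ?thesis
      by (simp add: J_def)
  qed
  have [measurable]: "\<phi>' \<in> borel_measurable borel" "(\<lambda>x. det (J x)) \<in> borel_measurable borel"
    unfolding \<phi>'_def det_J by measurable
  have eq: "lborel = distr (density lborel (\<lambda>x. ennreal \<bar>det (J x)\<bar>)) borel \<phi>'"
    by (rule lborel_change_of_variables_wellorder) (auto simp: bij' der)
  show ?thesis
  proof (rule measure_eqI)
    fix B :: "(real^'d) set" assume "B \<in> sets lborel"
    then have [measurable]: "B \<in> sets borel" by simp
    \<comment> \<open>The chain moves to the ranked coordinates along \<open>U\<close>, substitutes
      \<open>\<phi>'\<close> there, and returns along \<open>T\<close>; then
      \<open>U (\<phi>' (T x))\<close> collapses to \<open>\<phi> x\<close>.\<close>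
    have "emeasure lborel B = emeasure (distr lborel borel U) B"
      using lU by simp
    also have "\<dots> = (\<integral>\<^sup>+x. indicator B (U x) \<partial>lborel)"
      by (simp add: nn_integral_distr flip: nn_integral_indicator)
    also have "\<dots> = (\<integral>\<^sup>+x. ennreal \<bar>det (J x)\<bar> * indicator B (U (\<phi>' x)) \<partial>lborel)"
      by (subst eq) (simp add: nn_integral_distr nn_integral_density)
    also have "\<dots> = (\<integral>\<^sup>+x. ennreal \<bar>det (J (T x))\<bar> * indicator B (U (\<phi>' (T x))) \<partial>lborel)"
      by (subst lT) (simp add: nn_integral_distr)
    also have "\<dots> = (\<integral>\<^sup>+x. ennreal \<bar>det (jacobian \<phi> (at x))\<bar> * indicator B (\<phi> x) \<partial>lborel)"
      by (simp add: det_J \<phi>'_def)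
    also have "\<dots> = emeasure (distr (density lborel (\<lambda>x. ennreal \<bar>det (jacobian \<phi> (at x))\<bar>)) borel \<phi>) B"
      by (simp add: nn_integral_distr nn_integral_density flip: nn_integral_indicator)
    finally show "emeasure lborel B = \<dots>" .
  qed simp
qed

section \<open>Transport of densities by the dynamics\<close>

lemma transport_pdf_borel [measurable]:
  assumes "diffeomorphism \<Psi>" and [measurable]: "p \<in> borel_measurable borel"
  shows "transport_pdf \<Psi> p \<in> borel_measurable borel"
proof -
  have C1: "C1_map (inv \<Psi>)" using assms by (simp add: diffeomorphism_def)
  note [measurable] = C1_map_borel[OF C1] borel_measurable_jacobian_det[OF C1]
  show ?thesis unfolding transport_pdf_def by measurable
qed

text \<open>The substitution is made with \<open>inv \<Psi>\<close>, whose Jacobian determinant is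
  the factor in \<open>transport_pdf\<close>; it turns \<open>G (\<Psi> z)\<close> back into
  \<open>G z\<close>.\<close>

lemma nn_integral_transport_pdf:
  fixes \<Psi> :: "real^'d \<Rightarrow> real^'d"
  assumes diffeo: "diffeomorphism \<Psi>"
    and [measurable]: "G \<in> borel_measurable borel" "p \<in> borel_measurable borel"
    and nonneg: "\<And>z. 0 \<le> p z"
  shows "(\<integral>\<^sup>+z. G (\<Psi> z) * ennreal (p z) \<partial>lborel)
    = (\<integral>\<^sup>+z. G z * ennreal (transport_pdf \<Psi> p z) \<partial>lborel)"
proof -
  have bij: "bij \<Psi>" and C1: "C1_map \<Psi>" and C1': "C1_map (inv \<Psi>)"
    using diffeo by (auto simp: diffeomorphism_def)
  note [measurable] = C1_map_borel[OF C1] C1_map_borel[OF C1'] borel_measurable_jacobian_det[OF C1']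
  have "(\<integral>\<^sup>+z. G (\<Psi> z) * ennreal (p z) \<partial>lborel)
      = (\<integral>\<^sup>+z. ennreal \<bar>det (jacobian (inv \<Psi>) (at z))\<bar> * (G (\<Psi> (inv \<Psi> z)) * ennreal (p (inv \<Psi> z))) \<partial>lborel)"
    by (subst lborel_change_of_variables[OF bij_imp_bij_inv[OF bij] C1'])
      (simp add: nn_integral_distr nn_integral_density)
  also have "\<dots> = (\<integral>\<^sup>+z. G z * ennreal (transport_pdf \<Psi> p z) \<partial>lborel)"
    using bij nonneg
    by (intro nn_integral_cong)
      (simp add: transport_pdf_def ennreal_mult bij_is_surj surj_f_inv_f mult_ac)
  finally show ?thesis .
qed

section \<open>Forecast and analysis densities\<close>

lemma sets_restrict_lborel [simp, measurable_cong]: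
  "sets (restrict_space lborel Z) = sets (restrict_space borel Z)"
  by (intro sets_restrict_space_cong) simp

lemma is_pdfD:
  assumes "is_pdf Z p"
  shows "p \<in> borel_measurable borel" "0 \<le> p z" "z \<notin> Z \<Longrightarrow> p z = 0"
    and "p \<in> borel_measurable (restrict_space borel Z)"
  using assms by (auto simp: is_pdf_def intro: measurable_restrict_space1)

lemma is_pdf_nn_integral:
  assumes Z: "Z \<in> sets borel" and p: "is_pdf Z p"
  shows "(\<integral>\<^sup>+z. ennreal (p z) \<partial>restrict_space lborel Z) = 1"
  using assms by (simp add: nn_integral_restrict_space is_pdf_def)

text \<open>The test function \<open>H\<close> is controlled only on \<open>Z\<close>, so it is
  extended by zero. This does not change the left side: \<open>p\<close> vanishes off
  \<open>Z\<close>, and \<open>\<Psi>\<close> keeps points of \<open>Z\<close> inside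
  \<open>Z\<close>.\<close>

lemma nn_integral_transport_pdf_on:
  fixes \<Psi> :: "real^'d \<Rightarrow> real^'d"
  assumes Z: "Z \<in> sets borel" and diffeo: "diffeomorphism \<Psi>" and inv: "\<Psi> ` Z \<subseteq> Z"
    and p: "is_pdf Z p" and H: "H \<in> borel_measurable (restrict_space borel Z)"
  shows "(\<integral>\<^sup>+z. H (\<Psi> z) * ennreal (p z) \<partial>restrict_space lborel Z)
    = (\<integral>\<^sup>+z. H z * ennreal (transport_pdf \<Psi> p z) \<partial>restrict_space lborel Z)"
proof -
  let ?G = "\<lambda>z. H z * indicator Z z"
  have \<Psi>: "\<Psi> z \<in> Z" if "z \<in> Z" for z
    using inv that by blast
  have G: "?G \<in> borel_measurable borel"
    using H Z by (simp add: borel_measurable_restrict_space_iff_ennreal)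
  have "(\<integral>\<^sup>+z. H (\<Psi> z) * ennreal (p z) \<partial>restrict_space lborel Z)
      = (\<integral>\<^sup>+z. ?G (\<Psi> z) * ennreal (p z) \<partial>lborel)"
    using Z \<Psi> is_pdfD(3)[OF p]
    by (auto simp: nn_integral_restrict_space indicator_def intro!: nn_integral_cong)
  also have "\<dots> = (\<integral>\<^sup>+z. ?G z * ennreal (transport_pdf \<Psi> p z) \<partial>lborel)"
    using is_pdfD[OF p] by (intro nn_integral_transport_pdf diffeo G) auto
  also have "\<dots> = (\<integral>\<^sup>+z. H z * ennreal (transport_pdf \<Psi> p z) \<partial>restrict_space lborel Z)"
    using Z by (simp add: nn_integral_restrict_space mult_ac)
  finally show ?thesis .
qed

text \<open>Total mass is preserved by the change of variables with test function 1. The density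
  vanishes off \<open>Z\<close> because a point whose preimage lies in \<open>Z\<close> lies in
  \<open>Z\<close> itself by forward invariance.\<close>

lemma is_pdf_transport:
  assumes Z: "Z \<in> sets borel" and diffeo: "diffeomorphism \<Psi>" and inv: "\<Psi> ` Z \<subseteq> Z"
    and p: "is_pdf Z p"
  shows "is_pdf Z (transport_pdf \<Psi> p)"
proof -
  have "transport_pdf \<Psi> p z = 0" if "z \<notin> Z" for z
  proof -
    have "\<Psi> (inv \<Psi> z) = z"
      using diffeo by (simp add: diffeomorphism_def bij_is_surj surj_f_inv_f)
    then have "inv \<Psi> z \<notin> Z"
      using inv that by force
    then show ?thesis
      by (simp add: transport_pdf_def is_pdfD(3)[OF p])
  qed
  moreover have "(\<integral>\<^sup>+z. ennreal (transport_pdf \<Psi> p z) \<partial>restrict_space lborel Z) = 1"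
    using nn_integral_transport_pdf_on[OF Z diffeo inv p, of "\<lambda>_. 1"] is_pdf_nn_integral[OF Z p]
    by simp
  moreover have "0 \<le> transport_pdf \<Psi> p z" for z
    by (simp add: transport_pdf_def is_pdfD(2)[OF p])
  ultimately show ?thesis
    using Z is_pdfD(1)[OF p] diffeo
    by (simp add: is_pdf_def nn_integral_restrict_space transport_pdf_borel)
qed

section \<open>Misfit weights and the Bayes update\<close>

lemma sym_pos_def_invertible:
  assumes "sym_pos_def R"
  shows "invertible R"
proof -
  have "x = 0" if "R *v x = 0" for x
    using assms that unfolding sym_pos_def_def by (metis inner_zero_right less_irrefl)
  then show ?thesis
    unfolding invertible_left_inverse matrix_left_invertible_ker by blast
qed

text \<open>With \<open>w\<close> the image of \<open>v\<close> under the inverse of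
  \<open>R\<close>, the quadratic form in the exponent equals \<open>w \<bullet> (R *v w)\<close>,
  which is nonnegative. The upper bound makes the Bayes integral finite, and strict positivity makes
  it nonzero.\<close>

lemma misfit_weight_bounds:
  assumes "sym_pos_def R"
  shows "0 < misfit_weight h R y z" "misfit_weight h R y z \<le> 1"
proof -
  define v where "v = h z - y"
  define w where "w = matrix_inv R *v v"
  have "R ** matrix_inv R = mat 1"
    using sym_pos_def_invertible[OF assms] unfolding invertible_def matrix_inv_def
    by (rule someI_ex[THEN conjunct1])
  then have "R *v w = v"
    by (simp add: w_def matrix_vector_mul_assoc)
  moreover have "0 \<le> w \<bullet> (R *v w)"
    using assms by (cases "w = 0") (auto simp: sym_pos_def_def less_imp_le)
  ultimately have "0 \<le> v \<bullet> w"
    by (simp add: inner_commute)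
  then show "0 < misfit_weight h R y z" "misfit_weight h R y z \<le> 1"
    by (simp_all add: misfit_weight_def v_def w_def)
qed

lemma misfit_weight_measurable:
  assumes "h \<in> borel_measurable M"
  shows "misfit_weight h R y \<in> borel_measurable M"
proof -
  have "continuous_on UNIV (\<lambda>v. exp (- (1/2) * ((v - y) \<bullet> (matrix_inv R *v (v - y)))))"
    by (intro continuous_intros
        linear_continuous_on_compose[OF _ matrix_vector_mul_linear])
  from borel_measurable_continuous_on[OF this assms] show ?thesis
    by (simp add: misfit_weight_def[abs_def])
qed

text \<open>The factor \<open>c\<close> stands for the Gaussian normalization, which cancels.\<close>

lemma bayes_pdf_scaled:
  fixes w f :: "real^'d \<Rightarrow> real"
  assumes Z: "Z \<in> sets borel" and f: "is_pdf Z f" and c: "c \<noteq> 0"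
    and w: "w \<in> borel_measurable (restrict_space borel Z)"
    and bounds: "\<And>z. 0 < w z" "\<And>z. w z \<le> 1"
  obtains I where "0 < I" "\<And>z. bayes_pdf Z (\<lambda>z. c * w z) f z = w z * f z / I"
    "is_pdf Z (bayes_pdf Z (\<lambda>z. c * w z) f)"
proof -
  let ?S = "restrict_space lborel Z"
  define I where "I = (\<integral>z. w z * f z \<partial>?S)"
  note f0 = is_pdfD(2,3)[OF f]
  have [measurable]: "w \<in> borel_measurable ?S" "f \<in> borel_measurable ?S"
    using w is_pdfD(4)[OF f] by (simp_all cong: measurable_cong_sets)
  have nonneg: "0 \<le> w z * f z" for z
    using bounds(1)[of z] f0 by simp
  have le: "w z * f z \<le> f z" for z
    using bounds(2)[of z] f0(1)[of z] mult_right_mono by fastforce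
  have "(\<integral>\<^sup>+z. ennreal (w z * f z) \<partial>?S) \<le> 1"
    unfolding is_pdf_nn_integral[OF Z f, symmetric]
    by (intro nn_integral_mono ennreal_leI le)
  then have fin: "(\<integral>\<^sup>+z. ennreal (w z * f z) \<partial>?S) < \<infinity>"
    by (simp add: le_less_trans)
  then have "integrable ?S (\<lambda>z. w z * f z)"
    by (intro integrableI_nonneg) (auto simp: nonneg)
  then have I: "(\<integral>\<^sup>+z. ennreal (w z * f z) \<partial>?S) = ennreal I"
    unfolding I_def by (intro nn_integral_eq_integral) (auto simp: nonneg)
  \<comment> \<open>If the normalization vanished, \<open>w z * f z\<close> would be zero almost
    everywhere; as \<open>w\<close> is strictly positive, so would \<open>f\<close>, contradicting
    its unit mass.\<close>
  have "I \<noteq> 0"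
  proof
    assume "I = 0"
    then have "AE z in ?S. ennreal (w z * f z) = 0"
      using I nn_integral_0_iff_AE[of "\<lambda>z. ennreal (w z * f z)" ?S] by simp
    then have "AE z in ?S. ennreal (f z) = 0"
    proof eventually_elim
      fix z assume "ennreal (w z * f z) = 0"
      then have "w z * f z = 0"
        using nonneg[of z] by (simp add: ennreal_eq_0_iff)
      then show "ennreal (f z) = 0"
        using bounds(1)[of z] by simp
    qed
    then have "(\<integral>\<^sup>+z. ennreal (f z) \<partial>?S) = 0"
      by (subst nn_integral_0_iff_AE) auto
    then show False
      using is_pdf_nn_integral[OF Z f] by simp
  qed
  moreover have "0 \<le> I"
    unfolding I_def by (intro Bochner_Integration.integral_nonneg nonneg)
  ultimately have pos: "0 < I" by simp
  have "(LINT z:Z|lborel. c * w z * f z) = c * I"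
    using Z by (simp add: I_def integral_restrict_space set_lebesgue_integral_def mult.assoc mult.left_commute[of _ c])
  then have eq: "bayes_pdf Z (\<lambda>z. c * w z) f = (\<lambda>z. w z * f z / I)"
    using c by (simp add: bayes_pdf_def mult.assoc fun_eq_iff)
  \<comment> \<open>Measurability of \<open>w\<close> is known on \<open>Z\<close> only, but
    \<open>f\<close> vanishes elsewhere, so the product equals its own extension by zero.\<close>
  have "(\<lambda>z. w z * f z) \<in> borel_measurable borel"
  proof -
    have "(\<lambda>z. indicator Z z *\<^sub>R (w z * f z)) \<in> borel_measurable borel"
      using Z w is_pdfD(4)[OF f] by (subst borel_measurable_restrict_space_iff[symmetric]) auto
    moreover have "(\<lambda>z. indicator Z z *\<^sub>R (w z * f z)) = (\<lambda>z. w z * f z)"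
      using f0 by (auto simp: fun_eq_iff indicator_def)
    ultimately show ?thesis by simp
  qed
  moreover have "(\<integral>\<^sup>+z. ennreal (w z * f z / I) \<partial>?S) = 1"
  proof -
    have "(\<integral>\<^sup>+z. ennreal (w z * f z / I) \<partial>?S) = (\<integral>\<^sup>+z. ennreal (w z * f z) / ennreal I \<partial>?S)"
      using pos nonneg by (simp add: divide_ennreal)
    also have "\<dots> = ennreal I / ennreal I"
      by (simp add: nn_integral_divide I)
    finally show ?thesis
      using pos by (simp add: divide_ennreal)
  qed
  ultimately have "is_pdf Z (bayes_pdf Z (\<lambda>z. c * w z) f)"
    using Z nonneg pos f0 by (simp add: is_pdf_def eq nn_integral_restrict_space)
  then show ?thesis
    using that pos by (simp add: eq)
qed

lemma bayes_pdf_likelihood: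
  assumes Z: "Z \<in> sets borel" and f: "is_pdf Z f" and R: "sym_pos_def R"
    and h: "h \<in> borel_measurable (restrict_space borel Z)"
  obtains I where "0 < I" "\<And>z. bayes_pdf Z (likelihood h R y) f z = misfit_weight h R y z * f z / I"
    "is_pdf Z (bayes_pdf Z (likelihood h R y) f)"
proof -
  \<comment> \<open>The real \<open>sqrt\<close> vanishes only at 0, so this makes the Gaussian
    constant nonzero.\<close>
  have "det R \<noteq> 0"
    using sym_pos_def_invertible[OF R] by (simp add: invertible_det_nz)
  then have c: "1 / ((2 * pi) powr (real CARD('b) / 2) * sqrt (det R)) \<noteq> 0"
    by simp
  show ?thesis
    by (rule bayes_pdf_scaled[OF Z f c misfit_weight_measurable[OF h, of R y]])
      (use R that in \<open>auto simp: misfit_weight_bounds likelihood_def[abs_def]\<close>)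
qed

text \<open>Transport and Bayes update both preserve PDFs, so no step of the recursion divides by
  zero.\<close>

lemma is_pdf_analysis:
  assumes "Z \<in> sets borel" "diffeomorphism \<Psi>" "\<Psi> ` Z \<subseteq> Z"
    and "h \<in> borel_measurable (restrict_space borel Z)" "sym_pos_def R" "is_pdf Z p\<^sub>0"
  shows "is_pdf Z (analysis_pdf Z \<Psi> h R y p\<^sub>0 n)"
proof (induction n)
  case (Suc n)
  show ?case
    using bayes_pdf_likelihood[OF assms(1) is_pdf_transport[OF assms(1-3) Suc] assms(5,4)]
    by (metis analysis_pdf.simps(2))
qed (simp add: assms)

section \<open>Laws of the chain and of the Feynman-Kac marginal\<close>

text \<open>The measure lives on the subspace \<open>Z\<close>, not on the whole space, so that it
  can be bound to kernels whose state space is \<open>Z\<close>.\<close>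

definition law :: "(real^'d) set \<Rightarrow> (real^'d \<Rightarrow> real) \<Rightarrow> (real^'d) measure" where
  "law Z p = density (restrict_space lborel Z) (\<lambda>z. ennreal (p z))"

lemma sets_law [simp, measurable_cong]: "sets (law Z p) = sets (restrict_space borel Z)"
  by (simp add: law_def)

lemma nn_integral_law:
  assumes "is_pdf Z p" and "H \<in> borel_measurable (restrict_space borel Z)"
  shows "(\<integral>\<^sup>+z. H z \<partial>law Z p) = (\<integral>\<^sup>+z. H z * ennreal (p z) \<partial>restrict_space lborel Z)"
proof -
  have "H \<in> borel_measurable (restrict_space lborel Z)" "p \<in> borel_measurable (restrict_space lborel Z)"
    using assms is_pdfD(4)[of Z p] by (simp_all cong: measurable_cong_sets)
  then show ?thesis
    by (simp add: law_def nn_integral_density mult.commute)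
qed

lemma emeasure_law:
  assumes "is_pdf Z p" and "B \<in> sets (restrict_space borel Z)"
  shows "emeasure (law Z p) B = (\<integral>\<^sup>+z. indicator B z * ennreal (p z) \<partial>restrict_space lborel Z)"
  using assms nn_integral_law[OF assms(1), of "indicator B"] by simp

lemma prob_space_law:
  assumes "Z \<in> sets borel" "is_pdf Z p"
  shows "prob_space (law Z p)"
  using nn_integral_law[of Z p "\<lambda>_. 1"] is_pdf_nn_integral[of Z p] assms
  by (intro prob_spaceI) simp

lemma distr_law_transport:
  fixes \<Psi> :: "real^'d \<Rightarrow> real^'d"
  assumes Z: "Z \<in> sets borel" and diffeo: "diffeomorphism \<Psi>" and inv: "\<Psi> ` Z \<subseteq> Z"
    and p: "is_pdf Z p" and meas: "\<Psi> \<in> restrict_space borel Z \<rightarrow>\<^sub>M restrict_space borel Z"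
  shows "distr (law Z p) (restrict_space borel Z) \<Psi> = law Z (transport_pdf \<Psi> p)"
proof (rule measure_eqI)
  fix B assume "B \<in> sets (distr (law Z p) (restrict_space borel Z) \<Psi>)"
  then have B: "B \<in> sets (restrict_space borel Z)" by simp
  have [measurable]: "\<Psi> \<in> law Z p \<rightarrow>\<^sub>M restrict_space borel Z"
    using meas by (simp cong: measurable_cong_sets)
  have "emeasure (distr (law Z p) (restrict_space borel Z) \<Psi>) B = (\<integral>\<^sup>+z. indicator B (\<Psi> z) \<partial>law Z p)"
    using B by (subst nn_integral_indicator[symmetric], simp) (subst nn_integral_distr, simp_all)
  also have "\<dots> = (\<integral>\<^sup>+z. indicator B (\<Psi> z) * ennreal (p z) \<partial>restrict_space lborel Z)"
    using measurable_compose[OF meas borel_measurable_indicator[OF B]]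
    by (intro nn_integral_law p)
  also have "\<dots> = emeasure (law Z (transport_pdf \<Psi> p)) B"
    using B by (simp add: nn_integral_transport_pdf_on[OF Z diffeo inv p] emeasure_law is_pdf_transport[OF Z diffeo inv p])
  finally show "emeasure (distr (law Z p) (restrict_space borel Z) \<Psi>) B = emeasure (law Z (transport_pdf \<Psi> p)) B" .
qed simp

text \<open>Evaluated on a Borel subset of \<open>Z\<close>, the bound measure is the left side of
  the consistency condition \<open>maps_density_to\<close>.\<close>

lemma law_bind_kernel:
  assumes Z: "Z \<in> sets borel" and p: "is_pdf Z p" and q: "is_pdf Z q"
    and K: "markov_kernel (restrict_space borel Z) K" and maps: "maps_density_to Z K p q"
  shows "law Z p \<bind> K = law Z q"
proof (rule measure_eqI)
  let ?S = "restrict_space borel Z"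
  have K': "K \<in> ?S \<rightarrow>\<^sub>M prob_algebra ?S"
    using K by (simp add: markov_kernel_def)
  have law: "law Z p \<in> space (prob_algebra ?S)"
    using prob_space_law[OF Z p] by (simp add: space_prob_algebra)
  show sets: "sets (law Z p \<bind> K) = sets (law Z q)"
    using sets_bind'[OF law K'] by simp
  fix B assume "B \<in> sets (law Z p \<bind> K)"
  then have B: "B \<in> sets ?S" using sets by simp
  then have B': "B \<in> sets borel" "B \<subseteq> Z"
    using Z by (auto simp: sets_restrict_space_iff)
  have "emeasure (law Z p \<bind> K) B = (\<integral>\<^sup>+z. emeasure (K z) B \<partial>law Z p)"
    by (rule emeasure_bind_prob_algebra[OF law K' B])
  also have "\<dots> = (\<integral>\<^sup>+z. emeasure (K z) B * ennreal (p z) \<partial>restrict_space lborel Z)"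
    using measurable_prob_algebraD[OF K'] B
    by (intro nn_integral_law p) (rule measurable_emeasure_kernel)
  also have "\<dots> = (\<integral>\<^sup>+z\<in>B. ennreal (q z) \<partial>lborel)"
    using maps B' Z by (simp add: maps_density_to_def nn_integral_restrict_space)
  also have "\<dots> = emeasure (law Z q) B"
    using B B' Z by (auto simp: emeasure_law q nn_integral_restrict_space indicator_def intro!: nn_integral_cong)
  finally show "emeasure (law Z p \<bind> K) B = emeasure (law Z q) B" .
qed

section \<open>One step of the chain\<close>

text \<open>Integrating the Markov property over the whole space removes the conditioning: the
  conditional probability integrates to the probability that \<open>X (Suc n)\<close> lies in
  \<open>B\<close>, and the kernel side becomes an integral against the law of
  \<open>X n\<close>.\<close>

lemma markov_chain_bind:
  assumes chain: "markov_chain M S N P X" and n: "n < N"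
    and P: "P (Suc n) \<in> S \<rightarrow>\<^sub>M prob_algebra S"
  shows "distr M S (X (Suc n)) = distr M S (X n) \<bind> P (Suc n)"
proof (rule measure_eqI)
  interpret prob_space M
    using chain by (simp add: markov_chain_def)
  have X [measurable]: "X k \<in> M \<rightarrow>\<^sub>M S" if "k \<le> N" for k
    using chain that by (simp add: markov_chain_def)
  have XS [measurable]: "X (Suc n) \<in> M \<rightarrow>\<^sub>M S" and Xn [measurable]: "X n \<in> M \<rightarrow>\<^sub>M S"
    using n by (auto intro!: X)
  have law: "distr M S (X n) \<in> space (prob_algebra S)"
    by (simp add: space_prob_algebra prob_space_distr)
  show sets: "sets (distr M S (X (Suc n))) = sets (distr M S (X n) \<bind> P (Suc n))"
    using sets_bind'[OF law P] by simp
  have past: "(\<lambda>\<omega>. \<lambda>k\<in>{..<Suc n}. X k \<omega>) \<in> M \<rightarrow>\<^sub>M (\<Pi>\<^sub>M k\<in>{..<Suc n}. S)"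
    using n by (intro measurable_restrict X) auto
  \<comment> \<open>The past consists of \<open>X 0\<close> up to \<open>X n\<close>, all measurable
    since \<open>n < N\<close>; the conditional expectation is thus taken over a genuine
    sub-sigma-algebra.\<close>
  have "subalgebra M (past_algebra M S X (Suc n))"
    unfolding subalgebra_def past_algebra_def
    using past by (auto simp: sets_vimage_algebra2[OF measurable_space[OF past, THEN funcsetI]] dest: measurable_sets)
  then interpret finite_measure_subalgebra M "past_algebra M S X (Suc n)"
    by unfold_locales
  fix B assume "B \<in> sets (distr M S (X (Suc n)))"
  then have B [measurable]: "B \<in> sets S" by simp
  let ?A = "X (Suc n) -` B \<inter> space M"
  let ?k = "\<lambda>\<omega>. measure (P (Suc n) (X n \<omega>)) B"
  have A: "?A \<in> sets M" by measurable
  have [measurable]: "(\<lambda>x. measure (P (Suc n) x) B) \<in> borel_measurable S"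
    using measurable_compose[OF measurable_prob_algebraD[OF P] measurable_measure_subprob_algebra[OF B]] .
  have pr: "prob_space (P (Suc n) (X n \<omega>))" if "\<omega> \<in> space M" for \<omega>
    using measurable_space[OF P measurable_space[OF Xn that]] by (simp add: space_prob_algebra)
  have bdd: "?k \<omega> \<le> 1" if "\<omega> \<in> space M" for \<omega>
    using prob_space.prob_le_1[OF pr[OF that]] .
  have int: "integrable M ?k"
    by (intro integrable_const_bound[of _ 1] AE_I2) (auto simp: bdd)
  have "integrable M (indicator ?A :: _ \<Rightarrow> real)"
    using A by (simp add: integrable_indicator_iff emeasure_eq_measure)
  then have "(\<integral>\<omega>. real_cond_exp M (past_algebra M S X (Suc n)) (indicator ?A) \<omega> \<partial>M) = measure M ?A"
    using A by (simp add: real_cond_exp_int)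
  moreover have "(\<integral>\<omega>. real_cond_exp M (past_algebra M S X (Suc n)) (indicator ?A) \<omega> \<partial>M) = (\<integral>\<omega>. ?k \<omega> \<partial>M)"
    using chain n B by (intro integral_cong_AE) (auto simp: markov_chain_def dest: bspec[of _ _ "Suc n"])
  ultimately have "emeasure M ?A = ennreal (\<integral>\<omega>. ?k \<omega> \<partial>M)"
    by (simp add: emeasure_eq_measure)
  also have "\<dots> = (\<integral>\<^sup>+\<omega>. ennreal (?k \<omega>) \<partial>M)"
    using int by (intro nn_integral_eq_integral[symmetric]) auto
  also have "\<dots> = (\<integral>\<^sup>+\<omega>. emeasure (P (Suc n) (X n \<omega>)) B \<partial>M)"
    using pr by (intro nn_integral_cong) (simp add: prob_space_def finite_measure.emeasure_eq_measure)
  also have "\<dots> = (\<integral>\<^sup>+x. emeasure (P (Suc n) x) B \<partial>distr M S (X n))"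
    using measurable_emeasure_kernel[OF measurable_prob_algebraD[OF P] B]
    by (subst nn_integral_distr) auto
  also have "\<dots> = emeasure (distr M S (X n) \<bind> P (Suc n)) B"
    by (rule emeasure_bind_prob_algebra[OF law P B, symmetric])
  finally show "emeasure (distr M S (X (Suc n))) B = emeasure (distr M S (X n) \<bind> P (Suc n)) B"
    by (simp add: emeasure_distr)
qed

text \<open>The density of \<open>X\<close> refers to the whole space while its law is taken on
  \<open>Z\<close>; Borel subsets of \<open>Z\<close> get the same mass from both.\<close>

lemma distributed_imp_law:
  fixes X :: "'w \<Rightarrow> real^'d"
  assumes Z: "Z \<in> sets borel" and p: "is_pdf Z p"
    and distr: "distributed M lborel X (\<lambda>z. ennreal (p z))"
    and X: "X \<in> M \<rightarrow>\<^sub>M restrict_space borel Z"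
  shows "distr M (restrict_space borel Z) X = law Z p"
proof (rule measure_eqI)
  fix B assume "B \<in> sets (distr M (restrict_space borel Z) X)"
  then have B: "B \<in> sets (restrict_space borel Z)" by simp
  then have B': "B \<in> sets borel" "B \<subseteq> Z"
    using Z by (auto simp: sets_restrict_space_iff)
  have "emeasure (distr M (restrict_space borel Z) X) B = emeasure M (X -` B \<inter> space M)"
    by (rule emeasure_distr[OF X B])
  also have "\<dots> = (\<integral>\<^sup>+z. ennreal (p z) * indicator B z \<partial>lborel)"
    using B' by (intro distributed_emeasure[OF distr]) simp
  also have "\<dots> = emeasure (law Z p) B"
    using B B' Z
    by (auto simp: emeasure_law p nn_integral_restrict_space indicator_def intro!: nn_integral_cong)
  finally show "emeasure (distr M (restrict_space borel Z) X) B = emeasure (law Z p) B" .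
qed simp

text \<open>Binding to the composed kernel amounts to pushing forward by \<open>\<Psi>\<close>,
  which gives the forecast law, and then binding to \<open>K n\<close>.\<close>

lemma mckean_step:
  fixes \<Psi> :: "real^'d \<Rightarrow> real^'d"
  assumes Z: "Z \<in> sets borel" and diffeo: "diffeomorphism \<Psi>" and inv: "\<Psi> ` Z \<subseteq> Z"
    and p: "is_pdf Z p" and q: "is_pdf Z q"
    and meas: "\<Psi> \<in> restrict_space borel Z \<rightarrow>\<^sub>M restrict_space borel Z"
    and K: "markov_kernel (restrict_space borel Z) (K n)"
    and maps: "maps_density_to Z (K n) (transport_pdf \<Psi> p) q"
  shows "law Z p \<bind> mckean_kernel \<Psi> K n = law Z q"
proof -
  let ?S = "restrict_space borel Z"
  have "K n \<in> ?S \<rightarrow>\<^sub>M subprob_algebra ?S"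
    using K by (simp add: markov_kernel_def measurable_prob_algebraD)
  moreover have "\<Psi> \<in> law Z p \<rightarrow>\<^sub>M ?S"
    using meas by (simp cong: measurable_cong_sets)
  ultimately have "law Z p \<bind> (\<lambda>z. K n (\<Psi> z)) = distr (law Z p) ?S \<Psi> \<bind> K n"
    using prob_space.not_empty[OF prob_space_law[OF Z p]] by (intro bind_distr[symmetric])
  also have "\<dots> = law Z q"
    by (simp add: distr_law_transport[OF Z diffeo inv p meas]
        law_bind_kernel[OF Z is_pdf_transport[OF Z diffeo inv p] q K maps])
  finally show ?thesis
    by (simp add: mckean_kernel_def[abs_def])
qed

section \<open>Weighted orbits and the Feynman-Kac marginal\<close>

lemma fk_weight_nonneg:
  assumes "sym_pos_def R" "is_pdf Z p\<^sub>0"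
  shows "0 \<le> fk_weight \<Psi> h R y p\<^sub>0 n z"
  unfolding fk_weight_def
  by (intro mult_nonneg_nonneg prod_nonneg ballI less_imp_le misfit_weight_bounds(1)
      is_pdfD(2)[OF assms(2)] assms(1))

text \<open>The constant \<open>c\<close> is the product of the Bayes normalizations up to time \<open>n\<close>.\<close>

lemma fk_weight_nn_integral:
  fixes \<Psi> :: "real^'d \<Rightarrow> real^'d" and h :: "real^'d \<Rightarrow> real^'m"
  assumes Z: "Z \<in> sets borel" and diffeo: "diffeomorphism \<Psi>" and inv: "\<Psi> ` Z \<subseteq> Z"
    and meas: "\<Psi> \<in> restrict_space borel Z \<rightarrow>\<^sub>M restrict_space borel Z"
    and h: "h \<in> borel_measurable (restrict_space borel Z)" and R: "sym_pos_def R"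
    and p: "is_pdf Z p\<^sub>0"
  shows "\<exists>c>0. \<forall>G\<in>borel_measurable (restrict_space borel Z).
    (\<integral>\<^sup>+z. G ((\<Psi> ^^ n) z) * ennreal (fk_weight \<Psi> h R y p\<^sub>0 n z) \<partial>restrict_space lborel Z)
      = ennreal c * (\<integral>\<^sup>+z. G z \<partial>law Z (analysis_pdf Z \<Psi> h R y p\<^sub>0 n))"
proof (induction n)
  case 0
  show ?case
    \<comment> \<open>At time 0 the product of weights is empty and only \<open>p\<^sub>0\<close>
      remains.\<close>
    by (rule exI[of _ 1]) (simp add: fk_weight_def nn_integral_law[OF p])
next
  case (Suc n)
  let ?S = "restrict_space borel Z" and ?L = "restrict_space lborel Z"
  let ?q = "analysis_pdf Z \<Psi> h R y p\<^sub>0"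
  let ?w = "misfit_weight h R (y (Suc n))"
  let ?f = "transport_pdf \<Psi> (?q n)"
  have q: "is_pdf Z (?q n)" for n
    by (rule is_pdf_analysis) fact+
  have f: "is_pdf Z ?f"
    by (rule is_pdf_transport[OF Z diffeo inv q])
  have w0: "0 < ?w z" for z
    by (rule misfit_weight_bounds[OF R])
  note [measurable] = meas misfit_weight_measurable[OF h] is_pdfD(4)[OF f]
  obtain c where c: "c > 0" and IH: "\<And>G. G \<in> borel_measurable ?S \<Longrightarrow>
      (\<integral>\<^sup>+z. G ((\<Psi> ^^ n) z) * ennreal (fk_weight \<Psi> h R y p\<^sub>0 n z) \<partial>?L)
        = ennreal c * (\<integral>\<^sup>+z. G z \<partial>law Z (?q n))"
    using Suc by blast
  obtain I where I: "I > 0" and qS: "\<And>z. ?q (Suc n) z = ?w z * ?f z / I"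
    using bayes_pdf_likelihood[OF Z f R h, of "y (Suc n)"] by (metis analysis_pdf.simps(2))
  show ?case
  \<comment> \<open>The new step contributes its own Bayes normalization \<open>I\<close>.\<close>
  proof (intro exI[of _ "c * I"] conjI ballI)
    show "c * I > 0" using c I by simp
    fix G :: "real^'d \<Rightarrow> ennreal" assume [measurable]: "G \<in> borel_measurable ?S"
    \<comment> \<open>The newest weight is absorbed into the test function. The induction
      hypothesis, which holds for all test functions, is then applied to \<open>?H\<close> composed
      with \<open>\<Psi>\<close>.\<close>
    let ?H = "\<lambda>z. G z * ennreal (?w z)"
    have [measurable]: "(\<lambda>z. ?H (\<Psi> z)) \<in> borel_measurable ?S"
      by (rule measurable_compose[OF meas]) measurable
    have "fk_weight \<Psi> h R y p\<^sub>0 (Suc n) z = ?w (\<Psi> ((\<Psi> ^^ n) z)) * fk_weight \<Psi> h R y p\<^sub>0 n z" for z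
      by (simp add: fk_weight_def mult_ac)
    moreover have "0 \<le> fk_weight \<Psi> h R y p\<^sub>0 n z" for z
      by (rule fk_weight_nonneg[OF R p])
    ultimately have "(\<integral>\<^sup>+z. G ((\<Psi> ^^ Suc n) z) * ennreal (fk_weight \<Psi> h R y p\<^sub>0 (Suc n) z) \<partial>?L)
        = (\<integral>\<^sup>+z. ?H (\<Psi> ((\<Psi> ^^ n) z)) * ennreal (fk_weight \<Psi> h R y p\<^sub>0 n z) \<partial>?L)"
      using w0 by (simp add: ennreal_mult less_imp_le mult_ac)
    also have "\<dots> = ennreal c * (\<integral>\<^sup>+z. ?H (\<Psi> z) \<partial>law Z (?q n))"
      by (rule IH) measurable
    also have "(\<integral>\<^sup>+z. ?H (\<Psi> z) \<partial>law Z (?q n)) = (\<integral>\<^sup>+z. ?H (\<Psi> z) * ennreal (?q n z) \<partial>?L)"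
      by (intro nn_integral_law q) measurable
    also have "\<dots> = (\<integral>\<^sup>+z. ?H z * ennreal (?f z) \<partial>?L)"
      by (intro nn_integral_transport_pdf_on Z diffeo inv q) measurable
    \<comment> \<open>The Bayes formula is read backwards: weight times forecast density is
      \<open>I\<close> times the next analysis density.\<close>
    also have "\<dots> = (\<integral>\<^sup>+z. ennreal I * (G z * ennreal (?q (Suc n) z)) \<partial>?L)"
    proof (intro nn_integral_cong)
      fix z
      have "ennreal (?w z) * ennreal (?f z) = ennreal I * ennreal (?q (Suc n) z)"
        using I w0[of z] is_pdfD(2)[OF q] is_pdfD(2)[OF f]
        by (subst (1 2) ennreal_mult[symmetric]) (simp_all only: qS, simp_all add: less_imp_le)
      then show "?H z * ennreal (?f z) = ennreal I * (G z * ennreal (?q (Suc n) z))"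
        by (simp add: mult.assoc mult.left_commute)
    qed
    also have "\<dots> = ennreal I * (\<integral>\<^sup>+z. G z * ennreal (?q (Suc n) z) \<partial>?L)"
      using is_pdfD(4)[OF q[of "Suc n"]]
      by (intro nn_integral_cmult) (simp cong: measurable_cong_sets del: analysis_pdf.simps)
    also have "(\<integral>\<^sup>+z. G z * ennreal (?q (Suc n) z) \<partial>?L) = (\<integral>\<^sup>+z. G z \<partial>law Z (?q (Suc n)))"
      by (intro nn_integral_law[symmetric] q) measurable
    finally show "(\<integral>\<^sup>+z. G ((\<Psi> ^^ Suc n) z) * ennreal (fk_weight \<Psi> h R y p\<^sub>0 (Suc n) z) \<partial>?L)
        = ennreal (c * I) * (\<integral>\<^sup>+z. G z \<partial>law Z (?q (Suc n)))"
      using c I by (simp add: ennreal_mult mult.assoc)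
  qed
qed

text \<open>The weighted initial law, pushed along the orbit to time \<open>N\<close>, is
  \<open>c\<close> times a probability measure. Testing with the constant 1 identifies
  \<open>c\<close> with \<open>fk_const\<close>, so the normalization leaves exactly the analysis
  law.\<close>

lemma feynman_kac_marginal:
  fixes \<Psi> :: "real^'d \<Rightarrow> real^'d" and h :: "real^'d \<Rightarrow> real^'m"
  assumes Z: "Z \<in> sets borel" and diffeo: "diffeomorphism \<Psi>" and inv: "\<Psi> ` Z \<subseteq> Z"
    and meas: "\<Psi> \<in> restrict_space borel Z \<rightarrow>\<^sub>M restrict_space borel Z"
    and h: "h \<in> borel_measurable (restrict_space borel Z)" and R: "sym_pos_def R"
    and p: "is_pdf Z p\<^sub>0"
  shows "distr (feynman_kac Z \<Psi> h R y p\<^sub>0 N) (restrict_space borel Z) (\<lambda>z. z N)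
    = law Z (analysis_pdf Z \<Psi> h R y p\<^sub>0 N)"
proof -
  let ?S = "restrict_space borel Z" and ?L = "restrict_space lborel Z"
  let ?q = "analysis_pdf Z \<Psi> h R y p\<^sub>0 N" and ?W = "fk_weight \<Psi> h R y p\<^sub>0 N"
  let ?C = "fk_const Z \<Psi> h R y p\<^sub>0 N"
  let ?D = "density ?L (\<lambda>z. ennreal (1 / ?C * ?W z))"
  have q: "is_pdf Z ?q"
    by (rule is_pdf_analysis) fact+
  have pow [measurable]: "(\<Psi> ^^ n) \<in> ?S \<rightarrow>\<^sub>M ?S" for n
    by (rule measurable_compose_n) (rule meas)
  have W [measurable]: "?W \<in> borel_measurable ?S"
    unfolding fk_weight_def[abs_def]
    using measurable_compose[OF pow misfit_weight_measurable[OF h]] is_pdfD(4)[OF p]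
    by measurable
  have W0: "0 \<le> ?W z" for z
    by (rule fk_weight_nonneg[OF R p])
  obtain c where c: "c > 0" and push: "\<And>G. G \<in> borel_measurable ?S \<Longrightarrow>
      (\<integral>\<^sup>+z. G ((\<Psi> ^^ N) z) * ennreal (?W z) \<partial>?L) = ennreal c * (\<integral>\<^sup>+z. G z \<partial>law Z ?q)"
    using fk_weight_nn_integral[OF Z diffeo inv meas h R p, of N y] by blast
  interpret q: prob_space "law Z ?q"
    by (rule prob_space_law[OF Z q])
  have "(\<integral>\<^sup>+z. ennreal (?W z) \<partial>?L) = ennreal c"
    using push[of "\<lambda>_. 1"] by (simp add: q.emeasure_space_1)
  moreover have "?C = integral\<^sup>L ?L ?W"
    using Z by (simp add: fk_const_def set_lebesgue_integral_def integral_restrict_space)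
  ultimately have C: "?C = c"
    using c W0 by (simp add: integral_eq_nn_integral)
  have orbit: "(\<lambda>z. \<lambda>n\<in>{0..N}. (\<Psi> ^^ n) z) \<in> ?D \<rightarrow>\<^sub>M (\<Pi>\<^sub>M n\<in>{0..N}. ?S)"
    by measurable
  \<comment> \<open>Coordinate \<open>N\<close> of the orbit map is \<open>\<Psi> ^^ N\<close>, so
    the marginal is an image of the weighted initial law under a single map.\<close>
  have "distr (feynman_kac Z \<Psi> h R y p\<^sub>0 N) ?S (\<lambda>z. z N) = distr ?D ?S (\<Psi> ^^ N)"
    unfolding feynman_kac_def
    by (subst distr_distr[OF _ orbit]) (auto simp: comp_def)
  also have "\<dots> = law Z ?q"
  proof (rule measure_eqI)
    fix B assume "B \<in> sets (distr ?D ?S (\<Psi> ^^ N))"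
    then have B [measurable]: "B \<in> sets ?S" by simp
    have "emeasure (distr ?D ?S (\<Psi> ^^ N)) B = (\<integral>\<^sup>+z. indicator B ((\<Psi> ^^ N) z) \<partial>?D)"
      by (subst nn_integral_indicator[symmetric], simp) (subst nn_integral_distr, simp_all)
    also have "\<dots> = (\<integral>\<^sup>+z. ennreal (1 / c) * (indicator B ((\<Psi> ^^ N) z) * ennreal (?W z)) \<partial>?L)"
      unfolding C using c W0
      by (subst nn_integral_density) (simp_all add: ennreal_mult mult_ac flip: times_divide_eq_left)
    also have "\<dots> = ennreal (1 / c) * (ennreal c * emeasure (law Z ?q) B)"
      by (subst nn_integral_cmult) (simp_all add: push)
    also have "\<dots> = emeasure (law Z ?q) B"
      using c by (simp add: mult.assoc[symmetric] ennreal_mult[symmetric])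
    finally show "emeasure (distr ?D ?S (\<Psi> ^^ N)) B = emeasure (law Z ?q) B" .
  qed simp
  finally show ?thesis .
qed

theorem corollary1:
  fixes Z :: "(real^'d) set" and \<Psi> :: "real^'d \<Rightarrow> real^'d"
    and h :: "real^'d \<Rightarrow> real^'m" and R :: "real^'m^'m" and y :: "nat \<Rightarrow> real^'m"
    and p\<^sub>0 :: "real^'d \<Rightarrow> real" and N :: nat
    and K :: "nat \<Rightarrow> real^'d \<Rightarrow> (real^'d) measure"
    and M :: "'w measure" and X :: "nat \<Rightarrow> 'w \<Rightarrow> real^'d"
  assumes "Z \<in> sets borel"
    and "diffeomorphism \<Psi>" and "\<Psi> ` Z \<subseteq> Z"
    and "h \<in> borel_measurable (restrict_space borel Z)"
    and "sym_pos_def R"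
    and "is_pdf Z p\<^sub>0"
    and "N \<ge> 1"
    and "\<And>n. n \<in> {1..N} \<Longrightarrow> markov_kernel (restrict_space borel Z) (K n)"
    and "\<And>n. n \<in> {1..N} \<Longrightarrow>
           maps_density_to Z (K n) (forecast_pdf Z \<Psi> h R y p\<^sub>0 n) (analysis_pdf Z \<Psi> h R y p\<^sub>0 n)"
    and "markov_chain M (restrict_space borel Z) N (mckean_kernel \<Psi> K) X"
    and "distributed M lborel (X 0) (\<lambda>z. ennreal (p\<^sub>0 z))"
  shows "distr (feynman_kac Z \<Psi> h R y p\<^sub>0 N) (restrict_space borel Z) (\<lambda>z. z N)
           = distr M (restrict_space borel Z) (X N)"
proof -
  let ?S = "restrict_space borel Z" and ?q = "analysis_pdf Z \<Psi> h R y p\<^sub>0"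
  have "\<Psi> \<in> borel_measurable borel"
    using assms(2) by (simp add: diffeomorphism_def C1_map_borel)
  then have meas: "\<Psi> \<in> ?S \<rightarrow>\<^sub>M ?S"
    using assms(3) by (intro measurable_restrict_space3) auto
  have q: "is_pdf Z (?q n)" for n
    using assms(1-6) by (rule is_pdf_analysis)
  have "distr M ?S (X n) = law Z (?q n)" if "n \<le> N" for n
    using that
  proof (induction n)
    case 0
    have "X 0 \<in> M \<rightarrow>\<^sub>M ?S"
      using assms(10) by (simp add: markov_chain_def)
    then show ?case
      using distributed_imp_law[OF assms(1,6,11)] by simp
  next
    case (Suc n)
    then have n: "Suc n \<in> {1..N}" by simp
    have "mckean_kernel \<Psi> K (Suc n) \<in> ?S \<rightarrow>\<^sub>M prob_algebra ?S"
      using measurable_compose[OF meas] assms(8)[OF n]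
      by (simp add: mckean_kernel_def[abs_def] markov_kernel_def)
    then have "distr M ?S (X (Suc n)) = distr M ?S (X n) \<bind> mckean_kernel \<Psi> K (Suc n)"
      using markov_chain_bind[OF assms(10), of n] n by simp
    also have "\<dots> = law Z (?q n) \<bind> mckean_kernel \<Psi> K (Suc n)"
      using Suc by simp
    also have "\<dots> = law Z (?q (Suc n))"
      \<comment> \<open>The forecast at \<open>Suc n\<close> unfolds to the transported analysis
        density at \<open>Suc n - 1\<close>, that is at \<open>n\<close>.\<close>
      using assms(9)[OF n]
      by (intro mckean_step[where K = K and n = "Suc n", OF assms(1-3) q[of n] q meas assms(8)[OF n]])
        (simp add: forecast_pdf_def del: analysis_pdf.simps)
    finally show ?case .
  qed
  then show ?thesis
    using feynman_kac_marginal[OF assms(1-3) meas assms(4-6)] by simp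
qed

end
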